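(* Let $N\ge 2$ and $n\ge 1$. Suppose the $N\times N$ real matrix $A$ satisfies $A\in\mathbf{A1}$ and is irreducible, let $\xi$ be its normalized left eigenvector for the eigenvalue $0$, and put $\Xi=\mathrm{diag}(\xi_1,\dots,\xi_N)$. Let $\Gamma=\mathrm{diag}(\gamma_1,\dots,\gamma_n)$ be positive definite, let $f:\mathbb{R}^n\times[0,\infty)\to\mathbb{R}^n$ be continuous with $f\in QUAD(\Delta,\varpi)$ for some real diagonal matrix $\Delta=\mathrm{diag}(\delta_1,\dots,\delta_n)$ and some $\varpi>0$, and let $\alpha>0$. Consider the coupled system with adaptive coupling strength $$\dot X(t)=F(X(t))+c(t)\,(A\otimes\Gamma)X(t),\qquad \dot c(t)=-\frac{\alpha}{2}X^T(t)\,(\Xi\otimes I_n)(A\otimes\Gamma)X(t),\qquad c(0)=0,$$ where $X(t)=(x_1^T(t),\dots,x_N^T(t))^T$ with $x_i(t)\in\mathbb{R}^n$, and $F(X(t))=(f(x_1(t),t)^T,\dots,f(x_N(t),t)^T)^T$. Then the system achieves synchronization: for every initial value $X(0)\in\mathbb{R}^{nN}$ and every solution $(X,c)$ on $[0,\infty)$ with that initial value and $c(0)=0$, one has $\lim_{t\to\infty}\|x_i(t)-x_j(t)\|=0$ for all $i,j=1,\dots,N$.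
   Context: A matrix $A=(a_{ij})_{i,j=1}^N$ satisfies Condition $\mathbf{A1}$ (written $A\in\mathbf{A1}$) if (1) $a_{ij}\ge 0$ for $i\ne j$ and $a_{ii}=-\sum_{j\neq i}a_{ij}$ for all $i$; (2) all eigenvalues of $A$ have negative real part except the eigenvalue $0$, which has multiplicity $1$. If $A\in\mathbf{A1}$ is irreducible, its normalized left eigenvector is the unique $\xi=(\xi_1,\dots,\xi_N)^T$ with $\xi^TA=0$, $\sum_i\xi_i=1$; it has all $\xi_i>0$. For a real diagonal matrix $\Delta=\mathrm{diag}(\delta_1,\dots,\delta_n)$ and $\varpi>0$, $f\in QUAD(\Delta,\varpi)$ means that $(x-y)^T[f(x,t)-f(y,t)]-(x-y)^T\Delta(x-y)\le-\varpi(x-y)^T(x-y)$ for all $x,y\in\mathbb{R}^n$ and all $t\ge 0$. $\otimes$ is the Kronecker product and $I_n$ the $n\times n$ identity matrix; $\|\cdot\|$ is any norm on $\mathbb{R}^n$. *)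

theory Defs
  imports "HOL-Analysis.Analysis" "HOL-Computational_Algebra.Polynomial"
begin

definition diag_matrix :: "'a::zero ^ 'n \<Rightarrow> 'a ^ 'n ^ 'n" where
  "diag_matrix d = (\<chi> i j. if i = j then d $ i else 0)"

text \<open>Rows and columns of a Kronecker product are indexed by pairs; the first
  component is the block index.\<close>

definition kronecker ::
  "'a::times ^ 'c1 ^ 'r1 \<Rightarrow> 'a ^ 'c2 ^ 'r2 \<Rightarrow> 'a ^ ('c1::finite \<times> 'c2::finite) ^ ('r1::finite \<times> 'r2::finite)"
  (infixl \<open>\<otimes>\<^sub>K\<close> 75) where
  "A \<otimes>\<^sub>K B = (\<chi> p q. A $ fst p $ fst q * B $ snd p $ snd q)"

definition block :: "'N \<Rightarrow> 'a ^ ('N::finite \<times> 'n::finite) \<Rightarrow> 'a ^ 'n" where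
  "block i X = (\<chi> k. X $ (i, k))"

definition positive_definite :: "real ^ 'n ^ 'n \<Rightarrow> bool" where
  "positive_definite M \<longleftrightarrow> transpose M = M \<and> (\<forall>x. x \<noteq> 0 \<longrightarrow> x \<bullet> (M *v x) > 0)"

definition eigenvalue :: "'a::field ^ 'n ^ 'n \<Rightarrow> 'a \<Rightarrow> bool" where
  "eigenvalue M z \<longleftrightarrow> (\<exists>v. v \<noteq> 0 \<and> M *v v = z *s v)"

definition char_poly :: "'a::comm_ring_1 ^ 'n ^ 'n \<Rightarrow> 'a poly" where
  "char_poly M = det (mat [:0, 1:] - map_matrix (\<lambda>a. [:a:]) M)"

definition eigenvalue_multiplicity :: "'a::field ^ 'n ^ 'n \<Rightarrow> 'a \<Rightarrow> nat" where
  "eigenvalue_multiplicity M z = order z (char_poly M)"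

text \<open>Eigenvalues of a real matrix are the complex ones, with algebraic multiplicity.\<close>

definition A1 :: "real ^ 'N ^ 'N \<Rightarrow> bool" where
  "A1 A \<longleftrightarrow>
     (\<forall>i j. i \<noteq> j \<longrightarrow> A $ i $ j \<ge> 0) \<and>
     (\<forall>i. A $ i $ i = - (\<Sum>j\<in>UNIV - {i}. A $ i $ j)) \<and>
     (\<forall>z. eigenvalue (map_matrix complex_of_real A) z \<and> z \<noteq> 0 \<longrightarrow> Re z < 0) \<and>
     eigenvalue (map_matrix complex_of_real A) 0 \<and>
     eigenvalue_multiplicity (map_matrix complex_of_real A) 0 = 1"

text \<open>A matrix is reducible if some simultaneous permutation of rows and columns makes it
  block triangular, i.e. if there is a zero block with rows in \<open>S\<close> and columns
  outside \<open>S\<close> for some nonempty proper index set \<open>S\<close>.\<close>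

definition irreducible_matrix :: "'a::zero ^ 'N ^ 'N \<Rightarrow> bool" where
  "irreducible_matrix A \<longleftrightarrow>
     \<not> (\<exists>S. S \<noteq> {} \<and> S \<noteq> UNIV \<and> (\<forall>i\<in>S. \<forall>j\<in>- S. A $ i $ j = 0))"

definition normalized_left_eigenvector :: "real ^ 'N ^ 'N \<Rightarrow> real ^ 'N \<Rightarrow> bool" where
  "normalized_left_eigenvector A \<xi> \<longleftrightarrow> \<xi> v* A = 0 \<and> (\<Sum>i\<in>UNIV. \<xi> $ i) = 1"

definition QUAD :: "real ^ 'n ^ 'n \<Rightarrow> real \<Rightarrow> (real ^ 'n \<Rightarrow> real \<Rightarrow> real ^ 'n) \<Rightarrow> bool" where
  "QUAD \<Delta> \<omega> f \<longleftrightarrow>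
     (\<forall>x y. \<forall>t\<ge>0. (x - y) \<bullet> (f x t - f y t) - (x - y) \<bullet> (\<Delta> *v (x - y))
                 \<le> - \<omega> * ((x - y) \<bullet> (x - y)))"

text \<open>An arbitrary norm, not necessarily the Euclidean \<^const>\<open>norm\<close>.\<close>

definition is_norm :: "('a::real_vector \<Rightarrow> real) \<Rightarrow> bool" where
  "is_norm \<nu> \<longleftrightarrow>
     (\<forall>x. \<nu> x \<ge> 0) \<and> (\<forall>x. \<nu> x = 0 \<longleftrightarrow> x = 0) \<and>
     (\<forall>a x. \<nu> (a *\<^sub>R x) = \<bar>a\<bar> * \<nu> x) \<and> (\<forall>x y. \<nu> (x + y) \<le> \<nu> x + \<nu> y)"

definition stacked ::
  "(real ^ 'n \<Rightarrow> real \<Rightarrow> real ^ 'n) \<Rightarrow> real ^ ('N \<times> 'n) \<Rightarrow> real \<Rightarrow> real ^ ('N::finite \<times> 'n::finite)" where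
  "stacked f X t = (\<chi> p. f (block (fst p) X) t $ snd p)"

text \<open>Solutions on \<open>[0, \<infinity>)\<close>, with the one-sided derivative at \<open>0\<close>.\<close>

definition adaptive_solution ::
  "real ^ 'N ^ 'N \<Rightarrow> real ^ 'N ^ 'N \<Rightarrow> real ^ 'n ^ 'n \<Rightarrow> (real ^ 'n \<Rightarrow> real \<Rightarrow> real ^ 'n) \<Rightarrow> real
    \<Rightarrow> (real \<Rightarrow> real ^ ('N::finite \<times> 'n::finite)) \<Rightarrow> (real \<Rightarrow> real) \<Rightarrow> bool" where
  "adaptive_solution A \<Xi> \<Gamma> f \<alpha> X c \<longleftrightarrow>
     (\<forall>t\<ge>0. (X has_vector_derivative
               stacked f (X t) t + c t *\<^sub>R ((A \<otimes>\<^sub>K \<Gamma>) *v X t)) (at t within {0..})) \<and>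
     (\<forall>t\<ge>0. (c has_real_derivative
               - (\<alpha> / 2) * (X t \<bullet> (((\<Xi> \<otimes>\<^sub>K mat 1) ** (A \<otimes>\<^sub>K \<Gamma>)) *v X t))) (at t within {0..})) \<and>
     c 0 = 0"

end

theory Submission
  imports Defs
begin

text \<open>The dispersion \<open>S = \<Sum>i j. \<xi> i \<xi> j |x i - x j|\<^sup>2\<close> is a Lyapunov function. As \<open>\<xi>\<close> is a left null vector,
  the coupling changes \<open>S\<close> at the rate \<open>- 4 c D\<close>, where \<open>D\<close> is a weighted sum of the \<open>\<Gamma>\<close>-weighted squares of the
  \<open>x i - x j\<close> over the edges of the graph of \<open>A\<close>; irreducibility makes this graph connected, so
  \<open>D \<ge> \<kappa> S\<close> for some \<open>\<kappa> > 0\<close>. The same \<open>D\<close> drives the gain, \<open>c' = \<alpha> D / 2\<close>, and QUAD bounds the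
  uncoupled growth of \<open>S\<close> by \<open>2 m S\<close>. If \<open>c\<close> exceeds \<open>m / (2 \<kappa>)\<close> by a margin, then \<open>S\<close> decays
  exponentially. Otherwise \<open>c\<close> is bounded and hence converges, and so does \<open>S\<close>, since \<open>S - L c\<close> is
  nonincreasing for large \<open>L\<close>; a positive limit of \<open>S\<close> would make \<open>c\<close> unbounded.\<close>

section \<open>Scalar differential inequalities\<close>

text \<open>Interior points of \<open>{s..t}\<close> are interior to \<open>{0..}\<close>, so there
  the derivative within the half line is the ordinary one; at the endpoints, in particular at a
  possible \<open>s = 0\<close>, continuity suffices.\<close>

lemma nonincreasing_on_half_line:
  fixes h h' :: "real \<Rightarrow> real"
  assumes der: "\<And>t. t \<ge> 0 \<Longrightarrow> (h has_real_derivative h' t) (at t within {0..})"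
    and nonpos: "\<And>t. t \<ge> T \<Longrightarrow> h' t \<le> 0"
    and "0 \<le> T" "T \<le> s" "s \<le> t"
  shows "h t \<le> h s"
proof (rule DERIV_nonpos_imp_decreasing_open[OF \<open>s \<le> t\<close>])
  show "\<exists>y. (h has_real_derivative y) (at u) \<and> y \<le> 0" if "s < u" "u < t" for u
  proof -
    have "u > 0" using that assms by linarith
    hence "at u within {0..} = at u"
      by (intro at_within_interior) auto
    moreover have "u \<ge> 0" "u \<ge> T" using that assms by linarith+
    ultimately show ?thesis using der[of u] nonpos[of u] by auto
  qed
  have "continuous_on {0..} h"
    using der by (intro DERIV_continuous_on) auto
  thus "continuous_on {s..t} h"
    by (rule continuous_on_subset) (use assms in auto)
qed

lemma tendsto_Inf_of_nonincreasing:
  fixes h :: "real \<Rightarrow> real"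
  assumes mono: "\<And>s t. 0 \<le> s \<Longrightarrow> s \<le> t \<Longrightarrow> h t \<le> h s"
    and bound: "\<And>t. t \<ge> 0 \<Longrightarrow> B \<le> h t"
  shows "(h \<longlongrightarrow> Inf (h ` {0..})) at_top"
proof (rule decreasing_tendsto)
  have bdd: "bdd_below (h ` {0..})" using bound by (intro bdd_belowI[of _ B]) auto
  show "\<forall>\<^sub>F t in at_top. Inf (h ` {0..}) \<le> h t"
    using eventually_ge_at_top[of 0] by eventually_elim (auto intro: cInf_lower bdd)
  fix x assume "Inf (h ` {0..}) < x"
  then obtain s where s: "s \<ge> 0" "h s < x"
    using bdd by (subst (asm) cInf_less_iff) auto
  show "\<forall>\<^sub>F t in at_top. h t < x"
    using eventually_ge_at_top[of s] by eventually_elim (use mono s in force)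
qed

text \<open>The scalar core of the argument, with \<open>W\<close> for the dispersion and
  \<open>c\<close> for the gain. The bound on \<open>W'\<close> is asked for only where
  \<open>c t \<ge> 0\<close>; this holds at all times, since \<open>c\<close> starts at
  \<open>0\<close> and \<open>c'\<close> is nonnegative.\<close>

lemma adaptive_gain_tendsto_zero:
  fixes W W' c c' :: "real \<Rightarrow> real"
  assumes derW: "\<And>t. t \<ge> 0 \<Longrightarrow> (W has_real_derivative W' t) (at t within {0..})"
    and derc: "\<And>t. t \<ge> 0 \<Longrightarrow> (c has_real_derivative c' t) (at t within {0..})"
    and W_nonneg: "\<And>t. t \<ge> 0 \<Longrightarrow> 0 \<le> W t"
    and c0: "c 0 = 0"
    and c': "\<And>t. t \<ge> 0 \<Longrightarrow> a * W t \<le> c' t"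
    and W': "\<And>t. t \<ge> 0 \<Longrightarrow> c t \<ge> 0 \<Longrightarrow> W' t \<le> (M - b * c t) * W t"
    and pos: "a > 0" "b > 0" "M > 0"
  shows "(W \<longlongrightarrow> 0) at_top"
proof -
  have c'_nonneg: "c' t \<ge> 0" if "t \<ge> 0" for t
    using c'[OF that] W_nonneg[OF that] pos by (meson mult_nonneg_nonneg less_imp_le order_trans)
  have c_mono: "c s \<le> c t" if "0 \<le> s" "s \<le> t" for s t
    using nonincreasing_on_half_line[of "\<lambda>t. - c t" "\<lambda>t. - c' t" 0 s t] derc c'_nonneg that
    by (auto intro: derivative_eq_intros)
  have c_nonneg: "c t \<ge> 0" if "t \<ge> 0" for t
    using c_mono[of 0 t] that c0 by simp
  show ?thesis
  proof (cases "\<exists>T\<ge>0. M + 1 \<le> b * c T")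
    case True
    then obtain T where T: "T \<ge> 0" "M + 1 \<le> b * c T" by blast
    \<comment> \<open>Since \<open>c\<close> is nondecreasing, the margin \<open>1\<close> in the
      choice of \<open>T\<close> persists and becomes the decay rate.\<close>
    have W'_le: "W' t \<le> - W t" if "t \<ge> T" for t
    proof -
      have "b * c T \<le> b * c t" using c_mono[of T t] T that pos by simp
      hence "(M - b * c t) * W t \<le> - 1 * W t"
        using T that W_nonneg[of t] by (intro mult_right_mono) auto
      thus ?thesis using W'[of t] c_nonneg[of t] T that by simp
    qed
    \<comment> \<open>\<open>exp t\<close> is the integrating factor of
      \<open>W' \<le> - W\<close>.\<close>
    have decay: "W t * exp t \<le> W T * exp T" if "t \<ge> T" for t
    proof (rule nonincreasing_on_half_line[of "\<lambda>t. W t * exp t" "\<lambda>t. (W' t + W t) * exp t" T])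
      show "((\<lambda>t. W t * exp t) has_real_derivative (W' u + W u) * exp u) (at u within {0..})"
        if "u \<ge> 0" for u
        by (rule derivative_eq_intros derW that refl)+ (simp add: algebra_simps)
      show "(W' u + W u) * exp u \<le> 0" if "u \<ge> T" for u
        using W'_le[OF that] by (simp add: mult_nonpos_nonneg)
    qed (use T that in auto)
    have "((\<lambda>t::real. exp (- t)) \<longlongrightarrow> 0) at_top"
      by (rule filterlim_compose[OF exp_at_bot filterlim_uminus_at_bot_at_top])
    hence lim: "((\<lambda>t. W T * exp T * exp (- t)) \<longlongrightarrow> 0) at_top"
      by (rule tendsto_mult_right_zero)
    show ?thesis
    proof (rule tendsto_sandwich[OF _ _ tendsto_const lim])
      show "\<forall>\<^sub>F t in at_top. 0 \<le> W t"
        using eventually_ge_at_top[of 0] by eventually_elim (rule W_nonneg)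
      show "\<forall>\<^sub>F t in at_top. W t \<le> W T * exp T * exp (- t)"
        using eventually_ge_at_top[of T]
        by eventually_elim (use decay in \<open>simp add: exp_minus field_simps\<close>)
    qed
  next
    case False
    define K where "K = (M + 1) / b"
    have c_le: "c t \<le> K" if "t \<ge> 0" for t
    proof -
      have "b * c t < M + 1" using False that by (meson not_le)
      thus ?thesis using pos by (simp add: K_def field_simps)
    qed
    \<comment> \<open>With this \<open>L\<close> the growth of \<open>W\<close> is paid for by the
      gain: \<open>W' \<le> M * W = L * (a * W) \<le> L * c'\<close>, so \<open>W - L * c\<close> is
      nonincreasing.\<close>
    define L where "L = M / a"
    have L: "L > 0" using pos by (simp add: L_def)
    define h where "h = (\<lambda>t. W t - L * c t)"
    have h_mono: "h t \<le> h s" if "0 \<le> s" "s \<le> t" for s t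
    proof (rule nonincreasing_on_half_line[of h "\<lambda>t. W' t - L * c' t" 0])
      show "(h has_real_derivative W' u - L * c' u) (at u within {0..})" if "u \<ge> 0" for u
        unfolding h_def by (rule derivative_eq_intros derW derc that refl)+ simp
      show "W' u - L * c' u \<le> 0" if "u \<ge> 0" for u
      proof -
        have "W' u \<le> (M - b * c u) * W u" using W' c_nonneg that by blast
        also have "\<dots> \<le> M * W u"
          using W_nonneg[OF that] c_nonneg[OF that] pos by (intro mult_right_mono) auto
        also have "\<dots> = L * (a * W u)" using pos by (simp add: L_def)
        also have "\<dots> \<le> L * c' u" using c'[OF that] L by simp
        finally show ?thesis by simp
      qed
    qed (use that in auto)
    have h_bound: "- L * K \<le> h t" if "t \<ge> 0" for t
    proof -
      have "L * c t \<le> L * K" using c_le[OF that] L by (intro mult_left_mono) auto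
      thus ?thesis using W_nonneg[OF that] by (simp add: h_def)
    qed
    have lim_h: "(h \<longlongrightarrow> Inf (h ` {0..})) at_top"
      by (rule tendsto_Inf_of_nonincreasing[OF h_mono h_bound])
    \<comment> \<open>The gain is nondecreasing and bounded by \<open>K\<close>; it enters with a
      minus sign to fit the lemma on nonincreasing functions. Hence the sign in \<open>w\<close>,
      which is the limit of \<open>h + L * c\<close>.\<close>
    have lim_c: "((\<lambda>t. - c t) \<longlongrightarrow> Inf ((\<lambda>t. - c t) ` {0..})) at_top"
      by (rule tendsto_Inf_of_nonincreasing[of _ "- K"]) (use c_mono c_le in auto)
    define w where "w = Inf (h ` {0..}) - L * Inf ((\<lambda>t. - c t) ` {0..})"
    have lim_W: "(W \<longlongrightarrow> w) at_top"
      using tendsto_diff[OF lim_h tendsto_mult[OF tendsto_const lim_c, of L]]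
      by (simp add: h_def w_def)
    have "\<forall>\<^sub>F t in at_top. 0 \<le> W t"
      using eventually_ge_at_top[of 0] by eventually_elim (rule W_nonneg)
    hence "w \<ge> 0"
      by (rule tendsto_lowerbound[OF lim_W]) simp
    \<comment> \<open>If the limit were positive, \<open>W\<close> would eventually exceed
      \<open>w / 2\<close>, so \<open>c\<close> would grow at least linearly, with slope
      \<open>r\<close>.\<close>
    moreover have False if "w > 0"
    proof -
      have "\<forall>\<^sub>F t in at_top. w / 2 < W t"
        using order_tendstoD(1)[OF lim_W, of "w / 2"] that by simp
      then obtain T0 where T0: "\<forall>t\<ge>T0. w / 2 < W t"
        unfolding eventually_at_top_linorder by blast
      define T where "T = max T0 0"
      define r where "r = a * (w / 2)"
      have r: "r > 0" using pos that by (simp add: r_def)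
      have T: "T \<ge> 0" by (simp add: T_def)
      have growth: "r * t - c t \<le> r * T - c T" if "t \<ge> T" for t
      proof (rule nonincreasing_on_half_line[of "\<lambda>t. r * t - c t" "\<lambda>t. r - c' t" T])
        show "((\<lambda>t. r * t - c t) has_real_derivative r - c' u) (at u within {0..})" if "u \<ge> 0" for u
          by (rule derivative_eq_intros derc that refl)+ simp
        show "r - c' u \<le> 0" if "u \<ge> T" for u
        proof -
          have "u \<ge> T0" "u \<ge> 0" using that by (auto simp: T_def)
          hence "r \<le> a * W u"
            unfolding r_def using T0 pos by (intro mult_left_mono) (auto intro: less_imp_le)
          thus ?thesis using c'[OF \<open>u \<ge> 0\<close>] by linarith
        qed
      qed (use T that in auto)
      \<comment> \<open>Slope \<open>r\<close> over a time span of length \<open>(K + 1) / r\<close>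
        adds at least \<open>K + 1\<close> to a nonnegative value, which breaks the bound
        \<open>K\<close>.\<close>
      have "K + 1 \<le> c (T + (K + 1) / r)"
      proof -
        have "0 \<le> K" using c_le[of 0] c0 by simp
        hence "(K + 1) / r \<ge> 0" using r by simp
        hence "r * (T + (K + 1) / r) - c (T + (K + 1) / r) \<le> r * T - c T"
          by (intro growth) simp
        moreover have "r * (T + (K + 1) / r) = r * T + (K + 1)" using r by (simp add: field_simps)
        ultimately show ?thesis using c_nonneg[OF T] by linarith
      qed
      moreover have "T + (K + 1) / r \<ge> 0"
        using T c_le[of 0] c0 r by simp
      ultimately show False using c_le by fastforce
    qed
    ultimately have "w = 0" by fastforce
    thus ?thesis using lim_W by simp
  qed
qed

section \<open>Irreducible matrices with zero row sums\<close>

text \<open>Isolating the diagonal term of column \<open>j\<close> and applying the triangle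
  inequality shows that each of these column sums is nonnegative. Summed over \<open>j\<close> they
  give \<open>0\<close>, because the rows of \<open>A\<close> sum to zero; so each of them
  vanishes.\<close>

lemma left_null_vector_abs:
  fixes A :: "real ^ 'N::finite ^ 'N"
  assumes off: "\<And>i j. i \<noteq> j \<Longrightarrow> 0 \<le> A $ i $ j"
    and rows: "\<And>i. (\<Sum>j\<in>UNIV. A $ i $ j) = 0"
    and null: "\<And>j. (\<Sum>i\<in>UNIV. \<xi> i * A $ i $ j) = 0"
  shows "(\<Sum>i\<in>UNIV. \<bar>\<xi> i\<bar> * A $ i $ j) = 0"
proof -
  have diag: "A $ j $ j \<le> 0" for j
    using rows[of j] sum_nonneg[of "UNIV - {j}" "\<lambda>k. A $ j $ k"] off
    by (auto simp: sum.remove[of UNIV j])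
  have nonneg: "0 \<le> (\<Sum>i\<in>UNIV. \<bar>\<xi> i\<bar> * A $ i $ j)" for j
  proof -
    have "\<xi> j * A $ j $ j = - (\<Sum>i\<in>UNIV - {j}. \<xi> i * A $ i $ j)"
      using null[of j] by (simp add: sum.remove[of UNIV j])
    hence "\<bar>\<xi> j * A $ j $ j\<bar> \<le> (\<Sum>i\<in>UNIV - {j}. \<bar>\<xi> i * A $ i $ j\<bar>)"
      by (simp add: sum_abs)
    also have "\<dots> = (\<Sum>i\<in>UNIV - {j}. \<bar>\<xi> i\<bar> * A $ i $ j)"
      by (rule sum.cong) (use off in \<open>auto simp: abs_mult\<close>)
    finally show ?thesis
      using diag[of j] by (simp add: sum.remove[of UNIV j] abs_mult)
  qed
  have "(\<Sum>j\<in>UNIV. \<Sum>i\<in>UNIV. \<bar>\<xi> i\<bar> * A $ i $ j) = 0"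
    by (subst sum.swap) (simp add: sum_distrib_left[symmetric] rows)
  thus ?thesis
    using nonneg by (subst (asm) sum_nonneg_eq_0_iff) auto
qed

text \<open>The support \<open>S\<close> of \<open>\<eta>\<close> has no edge leaving it, so
  irreducibility makes it empty or everything.\<close>

lemma nonneg_left_null_vector_support:
  fixes A :: "real ^ 'N::finite ^ 'N"
  assumes off: "\<And>i j. i \<noteq> j \<Longrightarrow> 0 \<le> A $ i $ j"
    and irr: "irreducible_matrix A"
    and nonneg: "\<And>i. 0 \<le> \<eta> i"
    and null: "\<And>j. (\<Sum>i\<in>UNIV. \<eta> i * A $ i $ j) = 0"
  shows "(\<forall>i. \<eta> i = 0) \<or> (\<forall>i. \<eta> i > 0)"
proof -
  define S where "S = {i. \<eta> i > 0}"
  have "A $ i $ j = 0" if "i \<in> S" "j \<in> - S" for i j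
  proof -
    have "\<eta> j = 0" using that nonneg[of j] by (simp add: S_def)
    \<comment> \<open>The possibly negative diagonal entry is multiplied by
      \<open>\<eta> j = 0\<close>. The column sum thus consists of nonnegative terms, all of which
      must vanish.\<close>
    hence "\<forall>k\<in>UNIV. 0 \<le> \<eta> k * A $ k $ j"
      using off nonneg by (metis mult_nonneg_nonneg mult_zero_left order_refl)
    hence "\<eta> i * A $ i $ j = 0"
      using null[of j] by (subst (asm) sum_nonneg_eq_0_iff) auto
    thus ?thesis using that by (simp add: S_def)
  qed
  hence "S = {} \<or> S = UNIV"
    using irr unfolding irreducible_matrix_def by blast
  thus ?thesis using nonneg by (auto simp: S_def antisym_conv not_less)
qed

text \<open>A Perron-Frobenius argument: the support dichotomy is applied first to
  \<open>|\<xi>|\<close>, which shows that no entry vanishes, and then to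
  \<open>|\<xi>| - \<xi>\<close>, which excludes negative entries.\<close>

lemma left_null_vector_pos:
  fixes A :: "real ^ 'N::finite ^ 'N"
  assumes off: "\<And>i j. i \<noteq> j \<Longrightarrow> 0 \<le> A $ i $ j"
    and rows: "\<And>i. (\<Sum>j\<in>UNIV. A $ i $ j) = 0"
    and irr: "irreducible_matrix A"
    and null: "\<And>j. (\<Sum>i\<in>UNIV. \<xi> i * A $ i $ j) = 0"
    and total: "(\<Sum>i\<in>UNIV. \<xi> i) = 1"
  shows "\<xi> i > 0"
proof -
  have abs_null: "(\<Sum>i\<in>UNIV. \<bar>\<xi> i\<bar> * A $ i $ j) = 0" for j
    by (rule left_null_vector_abs) (use off rows null in auto)
  have "(\<forall>i. \<bar>\<xi> i\<bar> = 0) \<or> (\<forall>i. \<bar>\<xi> i\<bar> > 0)"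
    by (rule nonneg_left_null_vector_support[where A = A]) (use off irr abs_null in auto)
  hence nz: "\<xi> i \<noteq> 0" using total by auto
  have "(\<Sum>i\<in>UNIV. (\<bar>\<xi> i\<bar> - \<xi> i) * A $ i $ j) = 0" for j
    using abs_null[of j] null[of j] by (simp add: left_diff_distrib sum_subtractf)
  hence "(\<forall>i. \<bar>\<xi> i\<bar> - \<xi> i = 0) \<or> (\<forall>i. \<bar>\<xi> i\<bar> - \<xi> i > 0)"
    by (intro nonneg_left_null_vector_support[where A = A]) (use off irr in auto)
  \<comment> \<open>A positive difference means a negative entry, and not all entries can be
    negative when their sum is \<open>1\<close>.\<close>
  moreover have "\<not> (\<forall>i. \<bar>\<xi> i\<bar> - \<xi> i > 0)"
  proof
    assume "\<forall>i. \<bar>\<xi> i\<bar> - \<xi> i > 0"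
    hence "(\<Sum>i\<in>UNIV. \<xi> i) \<le> 0" by (intro sum_nonpos) (smt (verit))
    thus False using total by simp
  qed
  ultimately have "\<bar>\<xi> i\<bar> = \<xi> i" by auto
  thus ?thesis using nz by linarith
qed

section \<open>Connectivity of the coupling graph and a discrete Poincare inequality\<close>

lemma norm_diff_square_le:
  fixes a b c :: "'a::real_inner"
  shows "(norm (a - c))\<^sup>2 \<le> 2 * (norm (a - b))\<^sup>2 + 2 * (norm (b - c))\<^sup>2"
proof -
  have "norm (a - c) \<le> norm (a - b) + norm (b - c)"
    using norm_triangle_ineq[of "a - b" "b - c"] by simp
  hence "(norm (a - c))\<^sup>2 \<le> (norm (a - b) + norm (b - c))\<^sup>2"
    by (intro power_mono) auto
  also have "\<dots> \<le> 2 * (norm (a - b))\<^sup>2 + 2 * (norm (b - c))\<^sup>2"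
    using zero_le_power2[of "norm (a - b) - norm (b - c)"]
    by (simp add: power2_sum power2_diff)
  finally show ?thesis .
qed

text \<open>The vertices whose distance from \<open>i\<close> is controlled by the edge energy
  include \<open>i\<close> and are closed under following edges, so by irreducibility they are all
  vertices. The constant depends on \<open>i\<close> and \<open>j\<close> but not on
  \<open>x\<close>.\<close>

lemma irreducible_pairwise_bound:
  fixes A :: "real ^ 'N::finite ^ 'N"
  assumes off: "\<And>i j. i \<noteq> j \<Longrightarrow> 0 \<le> A $ i $ j"
    and irr: "irreducible_matrix A"
    and \<xi>: "\<And>i. \<xi> i > 0"
  shows "\<exists>C\<ge>0. \<forall>x :: 'N \<Rightarrow> 'a::real_inner.
           (norm (x i - x j))\<^sup>2 \<le> C * (\<Sum>k\<in>UNIV. \<Sum>l\<in>UNIV. \<xi> k * A $ k $ l * (norm (x k - x l))\<^sup>2)"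
proof -
  define p where "p = (\<lambda>x :: 'N \<Rightarrow> 'a. \<Sum>k\<in>UNIV. \<Sum>l\<in>UNIV. \<xi> k * A $ k $ l * (norm (x k - x l))\<^sup>2)"
  have term_nonneg: "0 \<le> \<xi> k * A $ k $ l * (norm (x k - x l))\<^sup>2" for x :: "'N \<Rightarrow> 'a" and k l
    using off[of k l] \<xi>[of k] by (cases "k = l") (auto intro!: mult_nonneg_nonneg)
  have term_le: "\<xi> k * A $ k $ l * (norm (x k - x l))\<^sup>2 \<le> p x" for x k l
  proof -
    have "\<xi> k * A $ k $ l * (norm (x k - x l))\<^sup>2
            \<le> (\<Sum>l\<in>UNIV. \<xi> k * A $ k $ l * (norm (x k - x l))\<^sup>2)"
      by (rule member_le_sum) (auto intro: term_nonneg)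
    also have "\<dots> \<le> p x"
      unfolding p_def by (rule member_le_sum) (auto intro: term_nonneg sum_nonneg)
    finally show ?thesis .
  qed
  define S where "S = {j. \<exists>C\<ge>0. \<forall>x. (norm (x i - x j))\<^sup>2 \<le> C * p x}"
  have "i \<in> S" by (auto simp: S_def intro: exI[of _ 0])
  moreover have "A $ k $ l = 0" if kl: "k \<in> S" "l \<in> - S" for k l
  proof (rule ccontr)
    assume "A $ k $ l \<noteq> 0"
    hence pos: "\<xi> k * A $ k $ l > 0"
      using off[of k l] \<xi>[of k] kl by (cases "k = l") (auto intro!: mult_pos_pos)
    obtain C where C: "C \<ge> 0" "\<And>x. (norm (x i - x k))\<^sup>2 \<le> C * p x"
      using kl(1) by (auto simp: S_def)
    \<comment> \<open>The path is extended by the edge from \<open>k\<close> to \<open>l\<close>.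
      That edge alone contributes at most \<open>p x\<close>, whence the quotient; the factors
      \<open>2\<close> come from the squared triangle inequality.\<close>
    define C' where "C' = 2 * C + 2 / (\<xi> k * A $ k $ l)"
    have "(norm (x i - x l))\<^sup>2 \<le> C' * p x" for x
    proof -
      have "(norm (x k - x l))\<^sup>2 \<le> p x / (\<xi> k * A $ k $ l)"
        using term_le[of k l x] pos by (simp add: pos_le_divide_eq mult.commute)
      hence "(norm (x i - x l))\<^sup>2 \<le> 2 * (C * p x) + 2 * (p x / (\<xi> k * A $ k $ l))"
        using norm_diff_square_le[of "x i" "x l" "x k"] C(2)[of x] by linarith
      thus ?thesis by (simp add: C'_def algebra_simps)
    qed
    moreover have "C' \<ge> 0" using C pos by (simp add: C'_def)
    ultimately have "l \<in> S" by (auto simp: S_def)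
    thus False using kl by simp
  qed
  ultimately have "S = UNIV"
    using irr unfolding irreducible_matrix_def by blast
  hence "j \<in> S" by simp
  thus ?thesis by (simp add: S_def p_def)
qed

lemma weighted_square_sum_le:
  fixes A :: "real ^ 'N::finite ^ 'N"
  assumes off: "\<And>i j. i \<noteq> j \<Longrightarrow> 0 \<le> A $ i $ j"
    and irr: "irreducible_matrix A"
    and \<xi>: "\<And>i. \<xi> i > 0"
  shows "\<exists>C>0. \<forall>x :: 'N \<Rightarrow> 'a::real_inner.
           (\<Sum>i\<in>UNIV. \<Sum>j\<in>UNIV. \<xi> i * \<xi> j * (norm (x i - x j))\<^sup>2)
             \<le> C * (\<Sum>i\<in>UNIV. \<Sum>j\<in>UNIV. \<xi> i * A $ i $ j * (norm (x i - x j))\<^sup>2)"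
proof -
  define p where "p = (\<lambda>x :: 'N \<Rightarrow> 'a. \<Sum>i\<in>UNIV. \<Sum>j\<in>UNIV. \<xi> i * A $ i $ j * (norm (x i - x j))\<^sup>2)"
  have p_nonneg: "p x \<ge> 0" for x
    unfolding p_def
  proof (intro sum_nonneg)
    show "0 \<le> \<xi> k * A $ k $ l * (norm (x k - x l))\<^sup>2" for k l
      using off[of k l] \<xi>[of k] by (cases "k = l") (auto intro!: mult_nonneg_nonneg)
  qed
  have "\<forall>i j. \<exists>C\<ge>0. \<forall>x. (norm (x i - x j))\<^sup>2 \<le> C * p x"
    unfolding p_def by (intro allI irreducible_pairwise_bound) (use off irr \<xi> in auto)
  then obtain C where C: "\<And>i j. C i j \<ge> 0" "\<And>i j x. (norm (x i - x j))\<^sup>2 \<le> C i j * p x"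
    by metis
  define D where "D = (\<Sum>i\<in>UNIV. \<Sum>j\<in>UNIV. \<xi> i * \<xi> j * C i j)"
  have "D \<ge> 0" unfolding D_def
    by (intro sum_nonneg mult_nonneg_nonneg C less_imp_le[OF \<xi>])
  \<comment> \<open>\<open>D\<close> is only known to be nonnegative; adding \<open>1\<close> yields
    a positive constant, and the inequality survives because \<open>p\<close> is
    nonnegative.\<close>
  have "(\<Sum>i\<in>UNIV. \<Sum>j\<in>UNIV. \<xi> i * \<xi> j * (norm (x i - x j))\<^sup>2) \<le> (D + 1) * p x" for x
  proof -
    have "(\<Sum>i\<in>UNIV. \<Sum>j\<in>UNIV. \<xi> i * \<xi> j * (norm (x i - x j))\<^sup>2)
            \<le> (\<Sum>i\<in>UNIV. \<Sum>j\<in>UNIV. \<xi> i * \<xi> j * (C i j * p x))"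
      by (intro sum_mono mult_left_mono C mult_nonneg_nonneg less_imp_le[OF \<xi>])
    also have "\<dots> = D * p x"
      by (simp add: D_def sum_distrib_right mult.assoc)
    also have "\<dots> \<le> (D + 1) * p x" using p_nonneg by (intro mult_right_mono) auto
    finally show ?thesis .
  qed
  thus ?thesis using \<open>D \<ge> 0\<close> unfolding p_def by (intro exI[of _ "D + 1"]) auto
qed

section \<open>Block vectors and Kronecker products\<close>

lemma diag_matrix_mult_vec:
  fixes d :: "real ^ 'n::finite"
  shows "diag_matrix d *v x = (\<chi> k. d $ k * x $ k)"
  by (simp add: vec_eq_iff matrix_vector_mult_def diag_matrix_def if_distrib[of "\<lambda>a. a * _"]
      cong: if_cong)

lemma inner_diag_matrix_mult_vec:
  fixes d :: "real ^ 'n::finite"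
  shows "x \<bullet> (diag_matrix d *v y) = (\<Sum>k\<in>UNIV. d $ k * (x $ k * y $ k))"
  by (simp add: diag_matrix_mult_vec inner_vec_def algebra_simps)

text \<open>Lets the derivative of one agent's state be read off from that of the stacked
  state.\<close>

lemma bounded_linear_block: "bounded_linear (block i :: real ^ ('N::finite \<times> 'n::finite) \<Rightarrow> real ^ 'n)"
  by (rule linear_conv_bounded_linear[THEN iffD1], rule linearI)
     (simp_all add: block_def vec_eq_iff)

lemma inner_eq_sum_block:
  fixes X Y :: "real ^ ('N::finite \<times> 'n::finite)"
  shows "X \<bullet> Y = (\<Sum>i\<in>UNIV. block i X \<bullet> block i Y)"
  by (simp add: inner_vec_def block_def sum.cartesian_product UNIV_Times_UNIV[symmetric]
        del: UNIV_Times_UNIV)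

text \<open>Turns the Kronecker form of the coupling into the coupling term of a single
  agent.\<close>

lemma block_kronecker_mult:
  fixes A :: "real ^ 'N::finite ^ 'N" and B :: "real ^ 'n::finite ^ 'n"
  shows "block i ((A \<otimes>\<^sub>K B) *v X) = B *v (\<Sum>j\<in>UNIV. A $ i $ j *\<^sub>R block j X)"
proof -
  have "block i ((A \<otimes>\<^sub>K B) *v X) $ k = (B *v (\<Sum>j\<in>UNIV. A $ i $ j *\<^sub>R block j X)) $ k" for k
  proof -
    have "block i ((A \<otimes>\<^sub>K B) *v X) $ k
            = (\<Sum>j\<in>UNIV. \<Sum>l\<in>UNIV. A $ i $ j * B $ k $ l * X $ (j, l))"
      unfolding block_def kronecker_def matrix_vector_mult_def
      by (simp add: sum.cartesian_product UNIV_Times_UNIV[symmetric] split_beta del: UNIV_Times_UNIV)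
    also have "\<dots> = (\<Sum>l\<in>UNIV. \<Sum>j\<in>UNIV. A $ i $ j * B $ k $ l * X $ (j, l))"
      by (rule sum.swap)
    also have "\<dots> = (B *v (\<Sum>j\<in>UNIV. A $ i $ j *\<^sub>R block j X)) $ k"
      by (simp add: matrix_vector_mult_def block_def sum_distrib_left algebra_simps)
    finally show ?thesis .
  qed
  thus ?thesis by (simp add: vec_eq_iff)
qed

lemma block_diag_kronecker_mult:
  fixes \<xi> :: "real ^ 'N::finite" and X :: "real ^ ('N \<times> 'n::finite)"
  shows "block i ((diag_matrix \<xi> \<otimes>\<^sub>K mat 1) *v X) = \<xi> $ i *\<^sub>R block i X"
proof -
  have "(\<Sum>j\<in>UNIV. diag_matrix \<xi> $ i $ j *\<^sub>R block j X)
          = (\<Sum>j\<in>UNIV. if i = j then \<xi> $ i *\<^sub>R block j X else 0)"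
    unfolding diag_matrix_def by (intro sum.cong) auto
  thus ?thesis by (simp add: block_kronecker_mult)
qed

lemma block_stacked: "block i (stacked f X t) = f (block i X) t"
  by (subst vec_eq_iff) (simp add: block_def stacked_def)

section \<open>The dispersion and its dissipation\<close>

text \<open>In the expansion of the differences, zero row sums remove the terms in
  \<open>x i\<close> alone and zero column sums those in \<open>x j\<close> alone, leaving the cross
  terms. For the weights \<open>\<xi> i * A $ i $ j\<close>, zero column sums say that
  \<open>\<xi>\<close> is a left null vector.\<close>

lemma weighted_form_eq:
  fixes x :: "'N::finite \<Rightarrow> 'a::real_vector" and q :: "'a \<Rightarrow> 'a \<Rightarrow> real"
  assumes q: "bilinear q" and sym: "\<And>u v. q u v = q v u"
    and rows: "\<And>i. (\<Sum>j\<in>UNIV. w i j) = 0"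
    and cols: "\<And>j. (\<Sum>i\<in>UNIV. w i j) = 0"
  shows "(\<Sum>i\<in>UNIV. \<Sum>j\<in>UNIV. w i j * q (x i - x j) (x i - x j))
           = - 2 * (\<Sum>i\<in>UNIV. \<Sum>j\<in>UNIV. w i j * q (x i) (x j))"
proof -
  have "w i j * q (x i - x j) (x i - x j)
          = w i j * q (x i) (x i) + w i j * q (x j) (x j) - 2 * (w i j * q (x i) (x j))" for i j
    using sym[of "x j" "x i"] q by (simp add: bilinear_lsub bilinear_rsub algebra_simps)
  hence "(\<Sum>i\<in>UNIV. \<Sum>j\<in>UNIV. w i j * q (x i - x j) (x i - x j))
     = (\<Sum>i\<in>UNIV. \<Sum>j\<in>UNIV. w i j * q (x i) (x i)) + (\<Sum>i\<in>UNIV. \<Sum>j\<in>UNIV. w i j * q (x j) (x j))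
        - 2 * (\<Sum>i\<in>UNIV. \<Sum>j\<in>UNIV. w i j * q (x i) (x j))"
    by (simp add: sum.distrib sum_subtractf sum_distrib_left)
  moreover have "(\<Sum>i\<in>UNIV. \<Sum>j\<in>UNIV. w i j * q (x i) (x i)) = 0"
    by (simp add: sum_distrib_right[symmetric] rows)
  moreover have "(\<Sum>i\<in>UNIV. \<Sum>j\<in>UNIV. w i j * q (x j) (x j)) = 0"
    by (subst sum.swap) (simp add: sum_distrib_right[symmetric] cols)
  ultimately show ?thesis by simp
qed

text \<open>Both cross terms contain the vanishing weighted mean of \<open>y\<close>, and the two
  diagonal terms agree. It serves to evaluate the coupling part of the derivative of the
  dispersion.\<close>

lemma weighted_pair_inner:
  fixes x y :: "'N::finite \<Rightarrow> 'a::real_inner"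
  assumes total: "(\<Sum>i\<in>UNIV. \<xi> i) = 1"
    and zero: "(\<Sum>i\<in>UNIV. \<xi> i *\<^sub>R y i) = 0"
  shows "(\<Sum>i\<in>UNIV. \<Sum>j\<in>UNIV. \<xi> i * \<xi> j * ((x i - x j) \<bullet> (y i - y j)))
           = 2 * (\<Sum>i\<in>UNIV. \<xi> i * (x i \<bullet> y i))"
proof -
  have cross: "(\<Sum>i\<in>UNIV. \<Sum>j\<in>UNIV. \<xi> i * \<xi> j * (x i \<bullet> y j)) = 0"
  proof -
    have "(\<Sum>j\<in>UNIV. \<xi> i * \<xi> j * (x i \<bullet> y j)) = \<xi> i * (x i \<bullet> (\<Sum>j\<in>UNIV. \<xi> j *\<^sub>R y j))" for i
      by (simp add: inner_sum_right sum_distrib_left mult.assoc)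
    thus ?thesis by (simp add: zero)
  qed
  have cross': "(\<Sum>i\<in>UNIV. \<Sum>j\<in>UNIV. \<xi> i * \<xi> j * (x j \<bullet> y i)) = 0"
    using cross by (subst sum.swap) (simp add: mult.commute)
  have d1: "(\<Sum>i\<in>UNIV. \<Sum>j\<in>UNIV. \<xi> i * \<xi> j * (x i \<bullet> y i)) = (\<Sum>i\<in>UNIV. \<xi> i * (x i \<bullet> y i))"
  proof -
    have "(\<Sum>j\<in>UNIV. \<xi> i * \<xi> j * (x i \<bullet> y i)) = (\<Sum>j\<in>UNIV. \<xi> j) * (\<xi> i * (x i \<bullet> y i))" for i
      by (simp only: sum_distrib_right) (simp add: mult_ac)
    thus ?thesis by (simp add: total)
  qed
  have d2: "(\<Sum>i\<in>UNIV. \<Sum>j\<in>UNIV. \<xi> i * \<xi> j * (x j \<bullet> y j)) = (\<Sum>i\<in>UNIV. \<xi> i * (x i \<bullet> y i))"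
    using d1 by (subst sum.swap) (simp add: mult.commute)
  have "(\<Sum>i\<in>UNIV. \<Sum>j\<in>UNIV. \<xi> i * \<xi> j * ((x i - x j) \<bullet> (y i - y j)))
     = (\<Sum>i\<in>UNIV. \<Sum>j\<in>UNIV. \<xi> i * \<xi> j * (x i \<bullet> y i)) - (\<Sum>i\<in>UNIV. \<Sum>j\<in>UNIV. \<xi> i * \<xi> j * (x i \<bullet> y j))
       - (\<Sum>i\<in>UNIV. \<Sum>j\<in>UNIV. \<xi> i * \<xi> j * (x j \<bullet> y i)) + (\<Sum>i\<in>UNIV. \<Sum>j\<in>UNIV. \<xi> i * \<xi> j * (x j \<bullet> y j))"
    by (simp add: inner_diff_left inner_diff_right algebra_simps sum.distrib sum_subtractf)
  thus ?thesis using cross cross' d1 d2 by simp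
qed

text \<open>The upper half of the equivalence of norms: expanding a vector in the standard basis
  dominates \<open>\<nu>\<close> by a continuous function that vanishes at \<open>0\<close>.\<close>

lemma is_norm_tendsto_zero:
  fixes \<nu> :: "'a::euclidean_space \<Rightarrow> real"
  assumes \<nu>: "is_norm \<nu>" and lim: "(v \<longlongrightarrow> 0) F"
  shows "((\<lambda>t. \<nu> (v t)) \<longlongrightarrow> 0) F"
proof -
  have zero: "\<nu> 0 = 0" and add: "\<nu> (x + y) \<le> \<nu> x + \<nu> y" and scale: "\<nu> (r *\<^sub>R x) = \<bar>r\<bar> * \<nu> x" for x y r
    using \<nu> unfolding is_norm_def by auto
  have sum_le: "\<nu> (\<Sum>b\<in>B. g b) \<le> (\<Sum>b\<in>B. \<nu> (g b))" if "finite B" for B :: "'a set" and g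
    using that
  proof (induction B rule: finite_induct)
    case (insert b B)
    thus ?case using add[of "g b" "sum g B"] by simp
  qed (simp add: zero)
  have bound: "\<nu> u \<le> (\<Sum>b\<in>Basis. \<bar>u \<bullet> b\<bar> * \<nu> b)" for u
    using sum_le[of Basis "\<lambda>b. (u \<bullet> b) *\<^sub>R b"] by (simp add: euclidean_representation scale)
  have "((\<lambda>t. \<Sum>b\<in>Basis. \<bar>v t \<bullet> b\<bar> * \<nu> b) \<longlongrightarrow> (\<Sum>b\<in>Basis. \<bar>0 \<bullet> b\<bar> * \<nu> b)) F"
    by (intro tendsto_intros lim)
  hence "((\<lambda>t. \<Sum>b\<in>Basis. \<bar>v t \<bullet> b\<bar> * \<nu> b) \<longlongrightarrow> 0) F" by simp
  thus ?thesis
    by (rule tendsto_sandwich[OF _ _ tendsto_const, rotated 2])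
       (use \<nu> bound in \<open>auto simp: is_norm_def\<close>)
qed
text \<open>Testing with coordinate vectors shows that the diagonal entries are positive; the
  smallest of them is the constant \<open>g\<close>.\<close>

lemma positive_definite_diag_coercive:
  fixes \<gamma> :: "real ^ 'n::finite"
  assumes "positive_definite (diag_matrix \<gamma>)"
  shows "\<exists>g>0. \<forall>v. g * (norm v)\<^sup>2 \<le> v \<bullet> (diag_matrix \<gamma> *v v)"
proof -
  have pos: "\<gamma> $ k > 0" for k
  proof -
    have "axis k 1 \<bullet> (diag_matrix \<gamma> *v axis k 1) > 0"
      using assms by (simp add: positive_definite_def axis_eq_0_iff)
    thus ?thesis by (simp add: inner_axis' diag_matrix_mult_vec)
  qed
  define g where "g = Min (range (($) \<gamma>))"
  have "g > 0" unfolding g_def using pos by (subst Min_gr_iff) auto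
  moreover have "g * (norm v)\<^sup>2 \<le> v \<bullet> (diag_matrix \<gamma> *v v)" for v
  proof -
    have "g * (norm v)\<^sup>2 = (\<Sum>k\<in>UNIV. g * (v $ k * v $ k))"
      by (simp add: power2_norm_eq_inner inner_vec_def sum_distrib_left)
    also have "\<dots> \<le> (\<Sum>k\<in>UNIV. \<gamma> $ k * (v $ k * v $ k))"
      unfolding g_def by (intro sum_mono mult_right_mono) auto
    finally show ?thesis by (simp add: inner_diag_matrix_mult_vec)
  qed
  ultimately show ?thesis by blast
qed

text \<open>By \<open>weighted_form_eq\<close> the right-hand side is half the edge energy measured
  by the form of \<open>diag_matrix \<gamma>\<close>. Coercivity compares this with the Euclidean
  edge energy, and connectivity compares the latter with the dispersion.\<close>

lemma coupling_dissipation: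
  fixes A :: "real ^ 'N::finite ^ 'N" and \<gamma> :: "real ^ 'n::finite"
  assumes off: "\<And>i j. i \<noteq> j \<Longrightarrow> 0 \<le> A $ i $ j"
    and rows: "\<And>i. (\<Sum>j\<in>UNIV. A $ i $ j) = 0"
    and irr: "irreducible_matrix A"
    and null: "\<And>j. (\<Sum>i\<in>UNIV. \<xi> i * A $ i $ j) = 0"
    and \<xi>: "\<And>i. \<xi> i > 0"
    and \<gamma>: "positive_definite (diag_matrix \<gamma>)"
  shows "\<exists>\<kappa>>0. \<forall>x :: 'N \<Rightarrow> real ^ 'n.
           \<kappa> * (\<Sum>i\<in>UNIV. \<Sum>j\<in>UNIV. \<xi> i * \<xi> j * (norm (x i - x j))\<^sup>2)
             \<le> - (\<Sum>i\<in>UNIV. \<xi> i * (x i \<bullet> (diag_matrix \<gamma> *v (\<Sum>j\<in>UNIV. A $ i $ j *\<^sub>R x j))))"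
proof -
  define q where "q = (\<lambda>u v. u \<bullet> (diag_matrix \<gamma> *v v))"
  have q_bilinear: "bilinear q"
    unfolding bilinear_def q_def
    by (auto intro!: linearI simp: inner_add_left matrix_vector_right_distrib inner_add_right
        matrix_vector_mult_scaleR)
  have q_sym: "q u v = q v u" for u v
    by (simp add: q_def inner_diag_matrix_mult_vec mult_ac)
  obtain g where g: "g > 0" "\<And>v. g * (norm v)\<^sup>2 \<le> q v v"
    using positive_definite_diag_coercive[OF \<gamma>] unfolding q_def by blast
  have "\<exists>C>0. \<forall>x :: 'N \<Rightarrow> real ^ 'n.
          (\<Sum>i\<in>UNIV. \<Sum>j\<in>UNIV. \<xi> i * \<xi> j * (norm (x i - x j))\<^sup>2)
            \<le> C * (\<Sum>i\<in>UNIV. \<Sum>j\<in>UNIV. \<xi> i * A $ i $ j * (norm (x i - x j))\<^sup>2)"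
    by (rule weighted_square_sum_le) (use off irr \<xi> in auto)
  then obtain C where C: "C > 0" "\<And>x :: 'N \<Rightarrow> real ^ 'n.
          (\<Sum>i\<in>UNIV. \<Sum>j\<in>UNIV. \<xi> i * \<xi> j * (norm (x i - x j))\<^sup>2)
            \<le> C * (\<Sum>i\<in>UNIV. \<Sum>j\<in>UNIV. \<xi> i * A $ i $ j * (norm (x i - x j))\<^sup>2)"
    by blast
  \<comment> \<open>In the constant, \<open>g\<close> stems from coercivity, \<open>C\<close> from
    connectivity and \<open>2\<close> from the polarization in
    \<open>weighted_form_eq\<close>.\<close>
  have "g / (2 * C) * (\<Sum>i\<in>UNIV. \<Sum>j\<in>UNIV. \<xi> i * \<xi> j * (norm (x i - x j))\<^sup>2)
          \<le> - (\<Sum>i\<in>UNIV. \<xi> i * (x i \<bullet> (diag_matrix \<gamma> *v (\<Sum>j\<in>UNIV. A $ i $ j *\<^sub>R x j))))"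
    (is "_ * ?S \<le> - ?D") for x :: "'N \<Rightarrow> real ^ 'n"
  proof -
    define P where "P = (\<Sum>i\<in>UNIV. \<Sum>j\<in>UNIV. \<xi> i * A $ i $ j * (norm (x i - x j))\<^sup>2)"
    have "g / (2 * C) * ?S \<le> g / (2 * C) * (C * P)"
      using C g unfolding P_def by (intro mult_left_mono) auto
    also have "\<dots> = g * P / 2" using C by simp
    also have "g * P \<le> (\<Sum>i\<in>UNIV. \<Sum>j\<in>UNIV. \<xi> i * A $ i $ j * q (x i - x j) (x i - x j))"
    proof -
      have "\<xi> i * A $ i $ j * (g * (norm (x i - x j))\<^sup>2) \<le> \<xi> i * A $ i $ j * q (x i - x j) (x i - x j)"
        for i j
      \<comment> \<open>The diagonal is treated apart because \<open>A $ i $ i\<close> can be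
        negative; there both sides are \<open>0\<close>.\<close>
      proof (cases "i = j")
        case True
        thus ?thesis by (simp add: q_def)
      next
        case False
        thus ?thesis using off[of i j] less_imp_le[OF \<xi>[of i]] g(2) by (intro mult_left_mono) auto
      qed
      hence "(\<Sum>i\<in>UNIV. \<Sum>j\<in>UNIV. \<xi> i * A $ i $ j * (g * (norm (x i - x j))\<^sup>2))
               \<le> (\<Sum>i\<in>UNIV. \<Sum>j\<in>UNIV. \<xi> i * A $ i $ j * q (x i - x j) (x i - x j))"
        by (intro sum_mono)
      thus ?thesis by (simp add: P_def sum_distrib_left mult_ac)
    qed
    also have "\<dots> = - 2 * (\<Sum>i\<in>UNIV. \<Sum>j\<in>UNIV. \<xi> i * A $ i $ j * q (x i) (x j))"
      by (rule weighted_form_eq[OF q_bilinear q_sym])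
         (simp_all add: sum_distrib_left[symmetric] rows null)
    also have "(\<Sum>i\<in>UNIV. \<Sum>j\<in>UNIV. \<xi> i * A $ i $ j * q (x i) (x j)) = ?D"
    proof (rule sum.cong)
      fix i
      have "x i \<bullet> (diag_matrix \<gamma> *v (\<Sum>j\<in>UNIV. A $ i $ j *\<^sub>R x j)) = (\<Sum>j\<in>UNIV. A $ i $ j * q (x i) (x j))"
        by (simp add: q_def linear_sum[OF matrix_vector_mul_linear] matrix_vector_mult_scaleR inner_sum_right)
      thus "(\<Sum>j\<in>UNIV. \<xi> i * A $ i $ j * q (x i) (x j))
              = \<xi> i * (x i \<bullet> (diag_matrix \<gamma> *v (\<Sum>j\<in>UNIV. A $ i $ j *\<^sub>R x j)))"
        by (simp add: sum_distrib_left mult.assoc)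
    qed simp
    finally show ?thesis by simp
  qed
  moreover have "g / (2 * C) > 0" using g C by simp
  ultimately show ?thesis by blast
qed

text \<open>A diagonal form is at most the largest entry times the squared norm, and the term with
  \<open>\<omega>\<close> only lowers the bound. The constant is uniform in time, as a differential
  inequality for the dispersion requires.\<close>

lemma QUAD_diag_one_sided_Lipschitz:
  fixes \<delta> :: "real ^ 'n::finite"
  assumes "QUAD (diag_matrix \<delta>) \<omega> f" and "\<omega> > 0"
  shows "\<exists>m>0. \<forall>x y. \<forall>t\<ge>0. (x - y) \<bullet> (f x t - f y t) \<le> m * (norm (x - y))\<^sup>2"
proof -
  \<comment> \<open>The sum dominates every entry of \<open>\<delta>\<close>; the summand
    \<open>1\<close> makes \<open>m\<close> positive even for \<open>\<delta> = 0\<close>.\<close>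
  define m where "m = 1 + (\<Sum>k\<in>UNIV. \<bar>\<delta> $ k\<bar>)"
  have \<Delta>: "v \<bullet> (diag_matrix \<delta> *v v) \<le> m * (norm v)\<^sup>2" for v
  proof -
    have "\<delta> $ k \<le> m" for k
      using member_le_sum[of k UNIV "\<lambda>k. \<bar>\<delta> $ k\<bar>"] by (simp add: m_def)
    hence "(\<Sum>k\<in>UNIV. \<delta> $ k * (v $ k * v $ k)) \<le> (\<Sum>k\<in>UNIV. m * (v $ k * v $ k))"
      by (intro sum_mono mult_right_mono) auto
    thus ?thesis
      unfolding inner_diag_matrix_mult_vec
      by (simp add: power2_norm_eq_inner inner_vec_def sum_distrib_left)
  qed
  have "(x - y) \<bullet> (f x t - f y t) \<le> m * (norm (x - y))\<^sup>2" if "t \<ge> 0" for x y t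
  proof -
    have "(x - y) \<bullet> (f x t - f y t) - (x - y) \<bullet> (diag_matrix \<delta> *v (x - y)) \<le> - \<omega> * ((x - y) \<bullet> (x - y))"
      using assms(1) that unfolding QUAD_def by blast
    moreover have "\<omega> * ((x - y) \<bullet> (x - y)) \<ge> 0" using assms(2) by simp
    ultimately show ?thesis using \<Delta>[of "x - y"] by linarith
  qed
  moreover have "m > 0" unfolding m_def by (simp add: add_pos_nonneg sum_nonneg)
  ultimately show ?thesis by blast
qed

section \<open>Synchronization of the adaptively coupled system\<close>

theorem theorem1:
  fixes A :: "real ^ 'N::finite ^ 'N"
    and \<xi> :: "real ^ 'N"
    and \<gamma> \<delta> :: "real ^ 'n::finite"
    and f :: "real ^ 'n \<Rightarrow> real \<Rightarrow> real ^ 'n"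
    and \<omega> \<alpha> :: real
    and \<nu> :: "real ^ 'n \<Rightarrow> real"
  assumes "CARD('N) \<ge> 2"
    and "A1 A"
    and "irreducible_matrix A"
    and "normalized_left_eigenvector A \<xi>"
    and "positive_definite (diag_matrix \<gamma>)"
    and "continuous_on (UNIV \<times> {0..}) (\<lambda>(x, t). f x t)"
    and "\<omega> > 0"
    and "QUAD (diag_matrix \<delta>) \<omega> f"
    and "\<alpha> > 0"
    and "is_norm \<nu>"
  shows "\<forall>X0 X c. adaptive_solution A (diag_matrix \<xi>) (diag_matrix \<gamma>) f \<alpha> X c \<and> X 0 = X0 \<longrightarrow>
           (\<forall>i j. ((\<lambda>t. \<nu> (block i (X t) - block j (X t))) \<longlongrightarrow> 0) at_top)"
proof (intro allI impI)
  fix X0 :: "real ^ ('N \<times> 'n)" and X c i0 j0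
  assume "adaptive_solution A (diag_matrix \<xi>) (diag_matrix \<gamma>) f \<alpha> X c \<and> X 0 = X0"
  hence derX: "(X has_vector_derivative
               stacked f (X t) t + c t *\<^sub>R ((A \<otimes>\<^sub>K diag_matrix \<gamma>) *v X t)) (at t within {0..})"
    and derc: "(c has_real_derivative
               - (\<alpha> / 2) * (X t \<bullet> (((diag_matrix \<xi> \<otimes>\<^sub>K mat 1) ** (A \<otimes>\<^sub>K diag_matrix \<gamma>)) *v X t)))
               (at t within {0..})"
    and c0: "c 0 = 0" if "t \<ge> 0" for t
    using that unfolding adaptive_solution_def by auto
  have off: "0 \<le> A $ i $ j" if "i \<noteq> j" for i j
    using \<open>A1 A\<close> that unfolding A1_def by blast
  have rows: "(\<Sum>j\<in>UNIV. A $ i $ j) = 0" for i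
  proof -
    have "A $ i $ i = - (\<Sum>j\<in>UNIV - {i}. A $ i $ j)"
      using \<open>A1 A\<close> unfolding A1_def by blast
    thus ?thesis by (simp add: sum.remove[of UNIV i])
  qed
  have null: "(\<Sum>i\<in>UNIV. \<xi> $ i * A $ i $ j) = 0" for j
  proof -
    have "(\<xi> v* A) $ j = 0"
      using \<open>normalized_left_eigenvector A \<xi>\<close> by (simp add: normalized_left_eigenvector_def)
    thus ?thesis by (simp add: vector_matrix_mult_def mult.commute)
  qed
  have total: "(\<Sum>i\<in>UNIV. \<xi> $ i) = 1"
    using \<open>normalized_left_eigenvector A \<xi>\<close> by (simp add: normalized_left_eigenvector_def)
  \<comment> \<open>Positivity is not part of \<open>normalized_left_eigenvector\<close>; it is
    derived from irreducibility.\<close>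
  have \<xi>_pos: "\<xi> $ i > 0" for i
    by (rule left_null_vector_pos[where A = A]) (use off rows null total assms(3) in auto)

  define x where "x = (\<lambda>t i. block i (X t))"
  define y where "y = (\<lambda>t i. diag_matrix \<gamma> *v (\<Sum>j\<in>UNIV. A $ i $ j *\<^sub>R x t j))"
  define S where "S = (\<lambda>t. \<Sum>i\<in>UNIV. \<Sum>j\<in>UNIV. \<xi> $ i * \<xi> $ j * (norm (x t i - x t j))\<^sup>2)"
  define D where "D = (\<lambda>t. - (\<Sum>i\<in>UNIV. \<xi> $ i * (x t i \<bullet> y t i)))"
  \<comment> \<open>The intended derivative of \<open>S\<close>. In the coupling term, one factor
    \<open>2\<close> comes from differentiating a square, the other from
    \<open>weighted_pair_inner\<close>, and the minus sign from the definition of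
    \<open>D\<close>.\<close>
  define S' where "S' = (\<lambda>t. 2 * (\<Sum>i\<in>UNIV. \<Sum>j\<in>UNIV. \<xi> $ i * \<xi> $ j *
    ((x t i - x t j) \<bullet> (f (x t i) t - f (x t j) t))) - 4 * c t * D t)"

  have "\<exists>\<kappa>>0. \<forall>x :: 'N \<Rightarrow> real ^ 'n.
           \<kappa> * (\<Sum>i\<in>UNIV. \<Sum>j\<in>UNIV. \<xi> $ i * \<xi> $ j * (norm (x i - x j))\<^sup>2)
             \<le> - (\<Sum>i\<in>UNIV. \<xi> $ i * (x i \<bullet> (diag_matrix \<gamma> *v (\<Sum>j\<in>UNIV. A $ i $ j *\<^sub>R x j))))"
    by (rule coupling_dissipation) (use off rows null \<xi>_pos assms(3,5) in auto)
  then obtain \<kappa> where \<kappa>: "\<kappa> > 0" "\<And>t. \<kappa> * S t \<le> D t"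
    unfolding S_def D_def y_def by blast
  obtain m where m: "m > 0"
    "\<And>u v t. t \<ge> 0 \<Longrightarrow> (u - v) \<bullet> (f u t - f v t) \<le> m * (norm (u - v))\<^sup>2"
    using QUAD_diag_one_sided_Lipschitz[OF assms(8,7)] by blast

  have derx: "((\<lambda>t. x t i) has_vector_derivative f (x t i) t + c t *\<^sub>R y t i) (at t within {0..})"
    if "t \<ge> 0" for t i
  proof -
    have "block i (stacked f (X t) t + c t *\<^sub>R ((A \<otimes>\<^sub>K diag_matrix \<gamma>) *v X t))
            = block i (stacked f (X t) t) + c t *\<^sub>R block i ((A \<otimes>\<^sub>K diag_matrix \<gamma>) *v X t)"
      by (simp add: block_def vec_eq_iff)
    also have "block i (stacked f (X t) t) = f (x t i) t"
      by (simp add: block_stacked x_def)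
    also have "block i ((A \<otimes>\<^sub>K diag_matrix \<gamma>) *v X t) = y t i"
      by (simp add: block_kronecker_mult y_def x_def)
    finally show ?thesis
      using bounded_linear.has_vector_derivative[OF bounded_linear_block derX[OF that], of i]
      by (simp add: x_def)
  qed
  \<comment> \<open>The quadratic form in the adaptation law is \<open>- D\<close>, so the gain is
    driven by the very quantity that dissipates \<open>S\<close>.\<close>
  have derc: "(c has_real_derivative \<alpha> / 2 * D t) (at t within {0..})" if "t \<ge> 0" for t
  proof -
    have "X t \<bullet> (((diag_matrix \<xi> \<otimes>\<^sub>K mat 1) ** (A \<otimes>\<^sub>K diag_matrix \<gamma>)) *v X t) = - D t"
      unfolding matrix_vector_mul_assoc[symmetric] inner_eq_sum_block block_diag_kronecker_mult
      by (simp add: block_kronecker_mult D_def y_def x_def)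
    thus ?thesis using derc[OF that] by simp
  qed
  \<comment> \<open>The weighted mean of the coupling terms vanishes because \<open>\<xi>\<close> is
    a left null vector.\<close>
  have y_zero: "(\<Sum>i\<in>UNIV. \<xi> $ i *\<^sub>R y t i) = 0" for t
  proof -
    have "(\<Sum>i\<in>UNIV. \<xi> $ i *\<^sub>R y t i)
            = diag_matrix \<gamma> *v (\<Sum>i\<in>UNIV. \<Sum>j\<in>UNIV. (\<xi> $ i * A $ i $ j) *\<^sub>R x t j)"
      by (simp add: y_def linear_sum[OF matrix_vector_mul_linear] matrix_vector_mult_scaleR
          scaleR_sum_right)
    also have "(\<Sum>i\<in>UNIV. \<Sum>j\<in>UNIV. (\<xi> $ i * A $ i $ j) *\<^sub>R x t j) = 0"
      by (subst sum.swap) (simp add: scaleR_sum_left[symmetric] null)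
    finally show ?thesis by simp
  qed
  have derS: "(S has_real_derivative S' t) (at t within {0..})" if "t \<ge> 0" for t
  proof -
    define x' where "x' = (\<lambda>i. f (x t i) t + c t *\<^sub>R y t i)"
    have "((\<lambda>t. (norm (x t i - x t j))\<^sup>2) has_real_derivative 2 * ((x t i - x t j) \<bullet> (x' i - x' j)))
            (at t within {0..})" for i j
    proof -
      have "((\<lambda>t. x t i - x t j) has_derivative (\<lambda>h. h *\<^sub>R (x' i - x' j))) (at t within {0..})"
        using has_vector_derivative_diff[OF derx[OF that, of i] derx[OF that, of j]]
        by (simp add: x'_def has_vector_derivative_def)
      from has_derivative_inner[OF this this] show ?thesis
        unfolding power2_norm_eq_inner has_field_derivative_def
        by (rule has_derivative_eq_rhs)
           (simp add: fun_eq_iff inner_commute[of "x' i - x' j"] del: inner_diff_left inner_diff_right)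
    qed
    hence "(S has_real_derivative (\<Sum>i\<in>UNIV. \<Sum>j\<in>UNIV. \<xi> $ i * \<xi> $ j *
             (2 * ((x t i - x t j) \<bullet> (x' i - x' j))))) (at t within {0..})"
      unfolding S_def by (intro DERIV_sum DERIV_cmult)
    also have "(\<Sum>i\<in>UNIV. \<Sum>j\<in>UNIV. \<xi> $ i * \<xi> $ j * (2 * ((x t i - x t j) \<bullet> (x' i - x' j))))
       = 2 * (\<Sum>i\<in>UNIV. \<Sum>j\<in>UNIV. \<xi> $ i * \<xi> $ j * ((x t i - x t j) \<bullet> (f (x t i) t - f (x t j) t)))
       + 2 * c t * (\<Sum>i\<in>UNIV. \<Sum>j\<in>UNIV. \<xi> $ i * \<xi> $ j * ((x t i - x t j) \<bullet> (y t i - y t j)))"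
    proof -
      have "\<xi> $ i * \<xi> $ j * (2 * ((x t i - x t j) \<bullet> (x' i - x' j)))
          = 2 * (\<xi> $ i * \<xi> $ j * ((x t i - x t j) \<bullet> (f (x t i) t - f (x t j) t)))
          + 2 * c t * (\<xi> $ i * \<xi> $ j * ((x t i - x t j) \<bullet> (y t i - y t j)))" for i j
      proof -
        have "x' i - x' j = (f (x t i) t - f (x t j) t) + c t *\<^sub>R (y t i - y t j)"
          by (simp add: x'_def algebra_simps)
        hence "(x t i - x t j) \<bullet> (x' i - x' j)
            = (x t i - x t j) \<bullet> (f (x t i) t - f (x t j) t) + c t * ((x t i - x t j) \<bullet> (y t i - y t j))"
          by (simp only: inner_add_right inner_scaleR_right)
        thus ?thesis by (simp only:) (simp only: distrib_left mult_ac)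
      qed
      thus ?thesis by (simp only: sum.distrib sum_distrib_left)
    qed
    also have "\<dots> = S' t"
      by (simp add: weighted_pair_inner[OF total y_zero] S'_def D_def)
    finally show ?thesis .
  qed
  have S'_le: "S' t \<le> (2 * m - 4 * \<kappa> * c t) * S t" if "t \<ge> 0" "c t \<ge> 0" for t
  proof -
    have "(\<Sum>i\<in>UNIV. \<Sum>j\<in>UNIV. \<xi> $ i * \<xi> $ j * ((x t i - x t j) \<bullet> (f (x t i) t - f (x t j) t)))
        \<le> (\<Sum>i\<in>UNIV. \<Sum>j\<in>UNIV. \<xi> $ i * \<xi> $ j * (m * (norm (x t i - x t j))\<^sup>2))"
      by (intro sum_mono mult_left_mono mult_nonneg_nonneg m(2)[OF that(1)] less_imp_le[OF \<xi>_pos])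
    also have "\<dots> = m * S t" by (simp add: S_def sum_distrib_left mult_ac)
    finally have "S' t \<le> 2 * (m * S t) - 4 * c t * D t" by (simp add: S'_def)
    \<comment> \<open>Here the sign of \<open>c t\<close> matters: a nonnegative gain lets
      \<open>D\<close> be replaced by its lower bound \<open>\<kappa> * S\<close>.\<close>
    moreover have "c t * (\<kappa> * S t) \<le> c t * D t" using \<kappa>(2)[of t] that(2) by (rule mult_left_mono)
    ultimately show ?thesis by (simp add: algebra_simps)
  qed
  have S_nonneg: "0 \<le> S t" for t
    unfolding S_def using less_imp_le[OF \<xi>_pos] by (intro sum_nonneg mult_nonneg_nonneg) auto
  have lim_S: "(S \<longlongrightarrow> 0) at_top"
  proof (rule adaptive_gain_tendsto_zero[OF derS derc])
    show "\<alpha> / 2 * \<kappa> * S t \<le> \<alpha> / 2 * D t" for t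
      using \<kappa>(2)[of t] \<open>\<alpha> > 0\<close> by simp
    show "\<alpha> / 2 * \<kappa> > 0" "4 * \<kappa> > 0" "2 * m > 0" using \<kappa> m \<open>\<alpha> > 0\<close> by auto
  qed (use S_nonneg c0 S'_le in auto)

  \<comment> \<open>One summand of \<open>S\<close> controls the chosen pair of agents, since its
    weight is a positive constant.\<close>
  have "\<xi> $ i0 * \<xi> $ j0 * (norm (x t i0 - x t j0))\<^sup>2 \<le> S t" for t
  proof -
    have nn: "0 \<le> \<xi> $ i * \<xi> $ j * (norm (x t i - x t j))\<^sup>2" for i j
      using less_imp_le[OF \<xi>_pos] by (intro mult_nonneg_nonneg) auto
    have "\<xi> $ i0 * \<xi> $ j0 * (norm (x t i0 - x t j0))\<^sup>2
            \<le> (\<Sum>j\<in>UNIV. \<xi> $ i0 * \<xi> $ j * (norm (x t i0 - x t j))\<^sup>2)"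
      by (rule member_le_sum) (auto intro: nn)
    also have "\<dots> \<le> S t"
      unfolding S_def by (rule member_le_sum) (auto intro: nn sum_nonneg)
    finally show ?thesis .
  qed
  hence le: "(norm (x t i0 - x t j0))\<^sup>2 \<le> S t / (\<xi> $ i0 * \<xi> $ j0)" for t
    using \<xi>_pos by (simp add: pos_le_divide_eq mult.commute)
  have lim_bound: "((\<lambda>t. S t / (\<xi> $ i0 * \<xi> $ j0)) \<longlongrightarrow> 0) at_top"
    by (rule tendsto_divide_zero[OF lim_S])
  have "((\<lambda>t. (norm (x t i0 - x t j0))\<^sup>2) \<longlongrightarrow> 0) at_top"
    by (rule tendsto_sandwich[OF _ _ tendsto_const lim_bound]) (use le in auto)
  from tendsto_real_sqrt[OF this] have "((\<lambda>t. x t i0 - x t j0) \<longlongrightarrow> 0) at_top"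
    by (simp add: tendsto_norm_zero_iff)
  thus "((\<lambda>t. \<nu> (block i0 (X t) - block j0 (X t))) \<longlongrightarrow> 0) at_top"
    unfolding x_def by (rule is_norm_tendsto_zero[OF \<open>is_norm \<nu>\<close>])
qed

end
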